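(* Let $G$ be a finite group, $d$ a right-invariant metric on $G$, and let $\{P_0,P_1,\ldots,P_s\}$, with $P_0=\{e\}$, be the induced partition $P(G,d)$. Then $$\Gamma(G,d)=\bigcap_{1\le i\le s}\mathrm{Aut}\big(\mathrm{Cay}(G,P_i)\big).$$
   Context: A metric $d$ on a group $G$ is right-invariant if $d(gh,g'h)=d(g,g')$ for all $g,g',h\in G$. Its weight is $w(x)=d(x,e)$, and its induced partition $P(G,d)$ is the partition of $G$ into classes of the relation $g\sim h\iff w(g)=w(h)$; each part is closed under inversion and $\{e\}$ is a part. The symmetry group is $\Gamma(G,d)=\{\sigma\in\mathbb{S}_G: d(\sigma(x),\sigma(y))=d(x,y)\ \forall x,y\in G\}$, where $\mathbb{S}_G$ is the group of all permutations of the set $G$. For a subset $S\subseteq G$ with $e\notin S$ and $S=S^{-1}$, the Cayley graph $\mathrm{Cay}(G,S)$ is the simple graph with vertex set $G$ in which $g,h$ are adjacent iff $gh^{-1}\in S$; $\mathrm{Aut}(\mathrm{Cay}(G,S))\le\mathbb{S}_G$ is its group of graph automorphisms (adjacency-preserving permutations of $G$). *)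

theory Defs
  imports
    "HOL-Algebra.Bij"
    "HOL-Analysis.Abstract_Metric_Spaces"
    "Graph_Theory.Pair_Digraph"
begin

(* A permutation of the set S is an element of "carrier (BijGroup S)", i.e. a bijection of S
   that is undefined outside S. With this normalisation, functions agreeing on S are equal. *)

definition right_invariant ::
  "('a, 'm) monoid_scheme \<Rightarrow> ('a \<Rightarrow> 'a \<Rightarrow> real) \<Rightarrow> bool" where
  "right_invariant G d \<longleftrightarrow>
     (\<forall>g\<in>carrier G. \<forall>g'\<in>carrier G. \<forall>h\<in>carrier G.
        d (g \<otimes>\<^bsub>G\<^esub> h) (g' \<otimes>\<^bsub>G\<^esub> h) = d g g')"

definition weight ::
  "('a, 'm) monoid_scheme \<Rightarrow> ('a \<Rightarrow> 'a \<Rightarrow> real) \<Rightarrow> 'a \<Rightarrow> real" where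
  "weight G d x = d x \<one>\<^bsub>G\<^esub>"

definition induced_partition ::
  "('a, 'm) monoid_scheme \<Rightarrow> ('a \<Rightarrow> 'a \<Rightarrow> real) \<Rightarrow> 'a set set" where
  "induced_partition G d =
     carrier G // {(g, h). g \<in> carrier G \<and> h \<in> carrier G \<and> weight G d g = weight G d h}"

definition symmetry_group ::
  "('a, 'm) monoid_scheme \<Rightarrow> ('a \<Rightarrow> 'a \<Rightarrow> real) \<Rightarrow> ('a \<Rightarrow> 'a) set" where
  "symmetry_group G d =
     {\<sigma> \<in> carrier (BijGroup (carrier G)).
        \<forall>x\<in>carrier G. \<forall>y\<in>carrier G. d (\<sigma> x) (\<sigma> y) = d x y}"

(* As in Graph_Theory, a simple graph is a symmetric loop-free relation on its vertices;
   see cayley_graph_pair_graph. *)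
definition cayley_graph ::
  "('a, 'm) monoid_scheme \<Rightarrow> 'a set \<Rightarrow> 'a pair_pre_digraph" where
  "cayley_graph G S =
     \<lparr> pverts = carrier G,
       parcs = {(g, h). g \<in> carrier G \<and> h \<in> carrier G \<and> g \<otimes>\<^bsub>G\<^esub> inv\<^bsub>G\<^esub> h \<in> S} \<rparr>"

definition graph_Aut :: "'a pair_pre_digraph \<Rightarrow> ('a \<Rightarrow> 'a) set" where
  "graph_Aut H =
     {\<sigma> \<in> carrier (BijGroup (pverts H)).
        \<forall>x\<in>pverts H. \<forall>y\<in>pverts H. (\<sigma> x, \<sigma> y) \<in> parcs H \<longleftrightarrow> (x, y) \<in> parcs H}"

lemma subgroup_BijGroupI:
  assumes sub: "X \<subseteq> Bij V" and one: "(\<lambda>x\<in>V. x) \<in> X"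
    and comp: "\<And>f g. f \<in> X \<Longrightarrow> g \<in> X \<Longrightarrow> compose V f g \<in> X"
    and inv: "\<And>f. f \<in> X \<Longrightarrow> (\<lambda>x\<in>V. inv_into V f x) \<in> X"
  shows "subgroup X (BijGroup V)"
proof -
  interpret group "BijGroup V" by (rule group_BijGroup)
  show ?thesis
  proof (rule subgroupI)
    show "X \<subseteq> carrier (BijGroup V)" using sub by (simp add: BijGroup_def)
    show "X \<noteq> {}" using one by auto
    show "inv\<^bsub>BijGroup V\<^esub> f \<in> X" if "f \<in> X" for f
      using that sub inv by (auto simp: inv_BijGroup)
    show "f \<otimes>\<^bsub>BijGroup V\<^esub> g \<in> X" if "f \<in> X" "g \<in> X" for f g
      using that sub comp by (auto simp: BijGroup_def)
  qed
qed

lemma Bij_mem: "f \<in> Bij V \<Longrightarrow> x \<in> V \<Longrightarrow> f x \<in> V"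
  by (auto simp: Bij_def bij_betw_def)

lemma Bij_inv_into:
  assumes "f \<in> Bij V" "x \<in> V"
  shows "inv_into V f x \<in> V" "f (inv_into V f x) = x"
  using assms by (auto simp: Bij_def bij_betw_def inv_into_into f_inv_into_f)

lemma graph_Aut_subgroup: "subgroup (graph_Aut H) (BijGroup (pverts H))"
proof (rule subgroup_BijGroupI)
  fix f assume f: "f \<in> graph_Aut H"
  then have B: "f \<in> Bij (pverts H)" by (simp add: graph_Aut_def BijGroup_def)
  have "(inv_into (pverts H) f x, inv_into (pverts H) f y) \<in> parcs H \<longleftrightarrow> (x, y) \<in> parcs H"
    if "x \<in> pverts H" "y \<in> pverts H" for x y
  proof -
    let ?u = "inv_into (pverts H) f x" and ?v = "inv_into (pverts H) f y"
    have "(f ?u, f ?v) \<in> parcs H \<longleftrightarrow> (?u, ?v) \<in> parcs H"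
      using f Bij_inv_into(1)[OF B] that unfolding graph_Aut_def by blast
    then show ?thesis using Bij_inv_into(2)[OF B] that by simp
  qed
  with B show "(\<lambda>x\<in>pverts H. inv_into (pverts H) f x) \<in> graph_Aut H"
    by (auto simp: graph_Aut_def BijGroup_def restrict_inv_into_Bij)
qed (auto simp: graph_Aut_def BijGroup_def id_Bij compose_Bij compose_eq Bij_mem)

lemma symmetry_group_subgroup:
  "subgroup (symmetry_group G d) (BijGroup (carrier G))"
proof (rule subgroup_BijGroupI)
  fix f assume f: "f \<in> symmetry_group G d"
  then have B: "f \<in> Bij (carrier G)" by (simp add: symmetry_group_def BijGroup_def)
  have "d (inv_into (carrier G) f x) (inv_into (carrier G) f y) = d x y"
    if "x \<in> carrier G" "y \<in> carrier G" for x y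
  proof -
    let ?u = "inv_into (carrier G) f x" and ?v = "inv_into (carrier G) f y"
    have "d (f ?u) (f ?v) = d ?u ?v"
      using f Bij_inv_into(1)[OF B] that unfolding symmetry_group_def by blast
    then show ?thesis using Bij_inv_into(2)[OF B] that by simp
  qed
  with B show "(\<lambda>x\<in>carrier G. inv_into (carrier G) f x) \<in> symmetry_group G d"
    by (auto simp: symmetry_group_def BijGroup_def restrict_inv_into_Bij)
qed (auto simp: symmetry_group_def BijGroup_def id_Bij compose_Bij compose_eq Bij_mem)

lemma cayley_graph_pair_graph:
  assumes "group G" "finite (carrier G)" "S \<subseteq> carrier G" "\<one>\<^bsub>G\<^esub> \<notin> S"
    and S: "(\<lambda>x. inv\<^bsub>G\<^esub> x) ` S = S"
  shows "pair_graph (cayley_graph G S)"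
proof -
  interpret group G by fact
  have sym: "h \<otimes>\<^bsub>G\<^esub> inv\<^bsub>G\<^esub> g \<in> S"
    if "g \<in> carrier G" "h \<in> carrier G" "g \<otimes>\<^bsub>G\<^esub> inv\<^bsub>G\<^esub> h \<in> S" for g h
  proof -
    have "inv\<^bsub>G\<^esub> (g \<otimes>\<^bsub>G\<^esub> inv\<^bsub>G\<^esub> h) \<in> S" using that S by blast
    with that show ?thesis by (simp add: inv_mult_group)
  qed
  have "finite (parcs (cayley_graph G S))"
    by (rule finite_subset[of _ "carrier G \<times> carrier G"])
      (auto simp: cayley_graph_def assms(2))
  then show ?thesis
    using assms sym
    by unfold_locales (auto simp: cayley_graph_def symmetric_def sym_def)
qed

lemma induced_partition_part:
  assumes "group G" "Metric_space (carrier G) d" "right_invariant G d"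
  shows "{\<one>\<^bsub>G\<^esub>} \<in> induced_partition G d"
    and "P \<in> induced_partition G d \<Longrightarrow> P \<subseteq> carrier G"
    and "P \<in> induced_partition G d \<Longrightarrow> P \<noteq> {\<one>\<^bsub>G\<^esub>} \<Longrightarrow> \<one>\<^bsub>G\<^esub> \<notin> P"
    and "P \<in> induced_partition G d \<Longrightarrow> (\<lambda>x. inv\<^bsub>G\<^esub> x) ` P = P"
proof -
  interpret group G by fact
  interpret Metric_space "carrier G" d by fact
  have w0: "weight G d x = weight G d \<one>\<^bsub>G\<^esub> \<longleftrightarrow> x = \<one>\<^bsub>G\<^esub>" if "x \<in> carrier G" for x
    using that by (simp add: weight_def)
  have winv: "weight G d (inv\<^bsub>G\<^esub> x) = weight G d x" if "x \<in> carrier G" for x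
  proof -
    have "d (inv\<^bsub>G\<^esub> x \<otimes>\<^bsub>G\<^esub> x) (\<one>\<^bsub>G\<^esub> \<otimes>\<^bsub>G\<^esub> x) = d (inv\<^bsub>G\<^esub> x) \<one>\<^bsub>G\<^esub>"
      using that assms(3) by (simp only: right_invariant_def inv_closed one_closed)
    with that show ?thesis by (simp add: weight_def commute)
  qed
  have part: "P \<in> induced_partition G d \<longleftrightarrow>
    (\<exists>x\<in>carrier G. P = {y \<in> carrier G. weight G d x = weight G d y})" for P
    by (fastforce simp: induced_partition_def quotient_def)
  show "{\<one>\<^bsub>G\<^esub>} \<in> induced_partition G d"
    unfolding part using w0 by (intro bexI[of _ "\<one>\<^bsub>G\<^esub>"]) (auto, metis)
  show "P \<subseteq> carrier G" if "P \<in> induced_partition G d"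
    using that unfolding part by auto
  show "\<one>\<^bsub>G\<^esub> \<notin> P" if "P \<in> induced_partition G d" "P \<noteq> {\<one>\<^bsub>G\<^esub>}"
  proof
    assume "\<one>\<^bsub>G\<^esub> \<in> P"
    with that(1) obtain x where "x \<in> carrier G"
      "P = {y \<in> carrier G. weight G d x = weight G d y}"
      "weight G d x = weight G d \<one>\<^bsub>G\<^esub>"
      unfolding part by auto
    then have "P = {y \<in> carrier G. weight G d y = weight G d \<one>\<^bsub>G\<^esub>}" by auto
    with w0 have "P = {\<one>\<^bsub>G\<^esub>}" by blast
    with that(2) show False by blast
  qed
  show "(\<lambda>x. inv\<^bsub>G\<^esub> x) ` P = P" if "P \<in> induced_partition G d"
  proof -
    have "inv\<^bsub>G\<^esub> y \<in> P" if "y \<in> P" for y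
      using that \<open>P \<in> induced_partition G d\<close> winv unfolding part by auto
    moreover have "y = inv\<^bsub>G\<^esub> (inv\<^bsub>G\<^esub> y)" if "y \<in> P" for y
      using that \<open>P \<in> induced_partition G d\<close> unfolding part by auto
    ultimately show ?thesis by blast
  qed
qed

end

theory Submission
  imports Defs
begin

(* By right-invariance, d x y is the weight of x y^-1, so d is determined by which part
   contains x y^-1. The part P_0 = {e}, which is left out of the intersection, only concerns
   pairs with x = y, and these are preserved by every permutation. *)

lemma induced_partition_iff:
  "P \<in> induced_partition G d \<longleftrightarrow>
    (\<exists>x\<in>carrier G. P = {y \<in> carrier G. weight G d y = weight G d x})"
  by (fastforce simp: induced_partition_def quotient_def)

text \<open>Parts are level sets of the weight, so the weight alone decides membership. This makes
  isometries graph automorphisms.\<close>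

lemma induced_partition_mem_cong:
  assumes "g \<in> carrier G" "h \<in> carrier G" "weight G d g = weight G d h"
    and "P \<in> induced_partition G d"
  shows "g \<in> P \<longleftrightarrow> h \<in> P"
proof -
  obtain x where "P = {y \<in> carrier G. weight G d y = weight G d x}"
    using assms(4) unfolding induced_partition_iff by blast
  with assms(1-3) show ?thesis by simp
qed

text \<open>Serves the opposite inclusion: once adjacency puts two elements in a common part, their
  weights, and hence the distances, agree.\<close>

lemma induced_partition_weight_eq:
  assumes "P \<in> induced_partition G d" "g \<in> P" "h \<in> P"
  shows "weight G d g = weight G d h"
proof -
  obtain x where "P = {y \<in> carrier G. weight G d y = weight G d x}"
    using assms(1) unfolding induced_partition_iff by blast
  with assms(2,3) show ?thesis by simp
qed

lemma induced_partition_cover: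
  assumes "g \<in> carrier G"
  obtains P where "P \<in> induced_partition G d" "g \<in> P"
proof
  show "{y \<in> carrier G. weight G d y = weight G d g} \<in> induced_partition G d"
    using assms unfolding induced_partition_iff by blast
qed (use assms in simp)

lemma (in group) weight_mult_inv:
  assumes "right_invariant G d" "x \<in> carrier G" "y \<in> carrier G"
  shows "weight G d (x \<otimes> inv y) = d x y"
proof -
  \<comment> \<open>Right translation by \<open>inv y\<close> moves the second point to the
    identity.\<close>
  have "d (x \<otimes> inv y) (y \<otimes> inv y) = d x y"
    using assms by (simp only: right_invariant_def inv_closed)
  with assms show ?thesis by (simp add: weight_def)
qed

text \<open>For trivial \<open>G\<close> the only part is \<open>P 0\<close>, so
  \<open>s = 0\<close> and the indexed intersection is the set of all functions. The factor
  \<open>carrier (BijGroup (carrier G))\<close> makes the empty intersection the full symmetric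
  group.\<close>

theorem theorem3p5:
  fixes G :: "('a, 'm) monoid_scheme"
    and d :: "'a \<Rightarrow> 'a \<Rightarrow> real"
    and P :: "nat \<Rightarrow> 'a set"
    and s :: nat
  assumes "group G"
    and "finite (carrier G)"
    and "Metric_space (carrier G) d"
    and "right_invariant G d"
    and "bij_betw P {0..s} (induced_partition G d)"
    and "P 0 = {\<one>\<^bsub>G\<^esub>}"
  shows "symmetry_group G d =
    carrier (BijGroup (carrier G)) \<inter> (\<Inter>i\<in>{1..s}. graph_Aut (cayley_graph G (P i)))"
proof -
  interpret group G by fact
  interpret Metric_space "carrier G" d by fact
  note weight = weight_mult_inv[OF assms(4)]
  have parts: "P ` {0..s} = induced_partition G d"
    using assms(5) by (simp add: bij_betw_def)
  have mem: "\<sigma> x \<in> carrier G"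
    if "\<sigma> \<in> carrier (BijGroup (carrier G))" "x \<in> carrier G" for \<sigma> x
    using that Bij_mem[of \<sigma> "carrier G" x] by (simp add: BijGroup_def)
  \<comment> \<open>A permutation keeps vertices in \<open>carrier G\<close>, so only the condition
    on the quotient remains from \<open>parcs\<close>.\<close>
  have Aut: "\<sigma> \<in> graph_Aut (cayley_graph G (P i)) \<longleftrightarrow>
      (\<forall>x\<in>carrier G. \<forall>y\<in>carrier G.
        \<sigma> x \<otimes>\<^bsub>G\<^esub> inv\<^bsub>G\<^esub> \<sigma> y \<in> P i \<longleftrightarrow> x \<otimes>\<^bsub>G\<^esub> inv\<^bsub>G\<^esub> y \<in> P i)"
    if "\<sigma> \<in> carrier (BijGroup (carrier G))" for \<sigma> i
    using that mem[OF that] by (simp add: graph_Aut_def cayley_graph_def)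
  show ?thesis
  proof (intro equalityI subsetI IntI INT_I)
    fix \<sigma> assume "\<sigma> \<in> symmetry_group G d"
    then have \<sigma>: "\<sigma> \<in> carrier (BijGroup (carrier G))"
      and iso: "\<And>x y. \<lbrakk>x \<in> carrier G; y \<in> carrier G\<rbrakk> \<Longrightarrow> d (\<sigma> x) (\<sigma> y) = d x y"
      by (auto simp: symmetry_group_def)
    show "\<sigma> \<in> carrier (BijGroup (carrier G))" by (rule \<sigma>)
    fix i assume "i \<in> {1..s}"
    then have "P i \<in> induced_partition G d" using parts by auto
    \<comment> \<open>Both quotients have weight \<open>d x y\<close>, the left one because
      \<open>\<sigma>\<close> is an isometry.\<close>
    then have "\<sigma> x \<otimes>\<^bsub>G\<^esub> inv\<^bsub>G\<^esub> \<sigma> y \<in> P i \<longleftrightarrow> x \<otimes>\<^bsub>G\<^esub> inv\<^bsub>G\<^esub> y \<in> P i"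
      if "x \<in> carrier G" "y \<in> carrier G" for x y
      using that mem[OF \<sigma>] by (intro induced_partition_mem_cong) (simp_all add: weight iso)
    then show "\<sigma> \<in> graph_Aut (cayley_graph G (P i))" by (simp add: Aut[OF \<sigma>])
  next
    fix \<sigma>
    assume "\<sigma> \<in> carrier (BijGroup (carrier G)) \<inter>
      (\<Inter>i\<in>{1..s}. graph_Aut (cayley_graph G (P i)))"
    then have \<sigma>: "\<sigma> \<in> carrier (BijGroup (carrier G))"
      and "\<And>i. i \<in> {1..s} \<Longrightarrow> \<sigma> \<in> graph_Aut (cayley_graph G (P i))"
      by blast+
    then have adj: "\<And>i x y. \<lbrakk>i \<in> {1..s}; x \<in> carrier G; y \<in> carrier G\<rbrakk> \<Longrightarrow>
        \<sigma> x \<otimes>\<^bsub>G\<^esub> inv\<^bsub>G\<^esub> \<sigma> y \<in> P i \<longleftrightarrow> x \<otimes>\<^bsub>G\<^esub> inv\<^bsub>G\<^esub> y \<in> P i"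
      using Aut[OF \<sigma>] by blast
    have "d (\<sigma> x) (\<sigma> y) = d x y" if xy: "x \<in> carrier G" "y \<in> carrier G" for x y
    proof (cases "x = y")
      case True
      with xy mem[OF \<sigma>] show ?thesis by simp
    next
      case False
      \<comment> \<open>The index \<open>i\<close> depends on the pair: it names the part containing
        the quotient, and the Cayley graph of that one part settles the distance.\<close>
      have "x \<otimes>\<^bsub>G\<^esub> inv\<^bsub>G\<^esub> y \<in> carrier G" using xy by simp
      then obtain Q where "Q \<in> induced_partition G d" "x \<otimes>\<^bsub>G\<^esub> inv\<^bsub>G\<^esub> y \<in> Q"
        by (rule induced_partition_cover)
      then obtain i where i: "i \<in> {0..s}" "x \<otimes>\<^bsub>G\<^esub> inv\<^bsub>G\<^esub> y \<in> P i"
        unfolding parts[symmetric] by blast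
      have "x \<otimes>\<^bsub>G\<^esub> inv\<^bsub>G\<^esub> y \<noteq> \<one>\<^bsub>G\<^esub>"
      proof
        assume "x \<otimes>\<^bsub>G\<^esub> inv\<^bsub>G\<^esub> y = \<one>\<^bsub>G\<^esub>"
        then have "inv\<^bsub>G\<^esub> (inv\<^bsub>G\<^esub> y) = x" using xy by (intro inv_equality) simp_all
        with False xy show False by simp
      qed
      \<comment> \<open>As \<open>P 0\<close> contains only the identity, \<open>i\<close> lies in
        \<open>{1..s}\<close>, the range in which \<open>adj\<close> applies.\<close>
      with i assms(6) have "i \<noteq> 0" by (metis singletonD)
      with i adj xy have "\<sigma> x \<otimes>\<^bsub>G\<^esub> inv\<^bsub>G\<^esub> \<sigma> y \<in> P i" by simp
      moreover have "P i \<in> induced_partition G d" using i parts by blast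
      \<comment> \<open>Both quotients lie in \<open>P i\<close>, so their weights agree; by
        \<open>weight\<close> these are the two distances.\<close>
      ultimately have "weight G d (\<sigma> x \<otimes>\<^bsub>G\<^esub> inv\<^bsub>G\<^esub> \<sigma> y) = weight G d (x \<otimes>\<^bsub>G\<^esub> inv\<^bsub>G\<^esub> y)"
        using i(2) by (intro induced_partition_weight_eq[of "P i"])
      with xy mem[OF \<sigma>] show ?thesis by (simp add: weight)
    qed
    with \<sigma> show "\<sigma> \<in> symmetry_group G d" by (simp add: symmetry_group_def)
  qed
qed

end
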